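(* For all positive integers $q$ and $r$, with $n=r(q-1)+1$, the winding permutation $3$--hypergraph $W_{q,r}$ satisfies $\chi(W_{q,r})=\left\lceil \frac{n}{r+1}\right\rceil$.
   Context: A cyclic permutation of $\{1,\dots,n\}$ is a class $[\phi]$ of bijections $\phi:\{1,\dots,n\}\to\{1,\dots,n\}$ modulo cyclic rotation ($\phi\sim\psi$ iff there is $k$ with $\phi(i)=\psi(i+k)$ for all $i$, indices mod $n$). Elements $i<j<k$ are in clockwise order with respect to $[\phi]$ if some $\psi\in[\phi]$ has $\psi^{-1}(i)<\psi^{-1}(j)<\psi^{-1}(k)$. The $3$--hypergraph associated to $[\phi]$ has vertex set $\{1,\dots,n\}$ and edges the triples $\{i,j,k\}$, $i<j<k$, in clockwise order with respect to $[\phi]$. For positive integers $q,r$, let $n=r(q-1)+1$ and define $\phi_{q,r}:\{1,\dots,n\}\to\{1,\dots,n\}$ by $\phi_{q,r}(n)=1$ and, for $1\le i<n$ with $i\equiv j \pmod r$, $1\le j\le r$, $\phi_{q,r}(i)=2+(q-1)(r-j)+\frac{i-j}{r}$. $W_{q,r}$ is the $3$--hypergraph associated to $[\phi_{q,r}]$ (e.g. for $q=5,r=3$ the permutation is $(10\,6\,2\,11\,7\,3\,12\,8\,4\,13\,9\,5\,1)$). The chromatic number $\chi(H)$ of a $3$--hypergraph is the minimum number of classes in a partition of its vertex set with no edge contained in a single class. *)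

theory Defs
  imports Complex_Main "HOL-Library.FuncSet" "HOL-Library.Disjoint_Sets"
begin

definition perms_upto :: "nat \<Rightarrow> (nat \<Rightarrow> nat) set" where
  "perms_upto n = {\<phi> \<in> extensional {1..n}. bij_betw \<phi> {1..n} {1..n}}"

text \<open>The representative in \<open>{1..n}\<close> of a positive index \<open>m\<close> modulo \<open>n\<close>.\<close>

definition cyc_index :: "nat \<Rightarrow> nat \<Rightarrow> nat" where
  "cyc_index n m = (m - 1) mod n + 1"

definition rotation_rel :: "nat \<Rightarrow> ((nat \<Rightarrow> nat) \<times> (nat \<Rightarrow> nat)) set" where
  "rotation_rel n = {(\<phi>, \<psi>). \<phi> \<in> perms_upto n \<and> \<psi> \<in> perms_upto n \<and>
     (\<exists>k::nat. \<forall>i\<in>{1..n}. \<phi> i = \<psi> (cyc_index n (i + k)))}"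

definition cyclic_perm :: "nat \<Rightarrow> (nat \<Rightarrow> nat) \<Rightarrow> (nat \<Rightarrow> nat) set" where
  "cyclic_perm n \<phi> = rotation_rel n `` {\<phi>}"

definition clockwise :: "nat \<Rightarrow> (nat \<Rightarrow> nat) set \<Rightarrow> nat \<Rightarrow> nat \<Rightarrow> nat \<Rightarrow> bool" where
  "clockwise n C i j k \<longleftrightarrow> (\<exists>\<psi>\<in>C.
     inv_into {1..n} \<psi> i < inv_into {1..n} \<psi> j \<and>
     inv_into {1..n} \<psi> j < inv_into {1..n} \<psi> k)"

type_synonym 'a hypergraph = "'a set \<times> 'a set set"

definition perm_hypergraph :: "nat \<Rightarrow> (nat \<Rightarrow> nat) set \<Rightarrow> nat hypergraph" where
  "perm_hypergraph n C =
     ({1..n}, {{i, j, k} | i j k. 1 \<le> i \<and> i < j \<and> j < k \<and> k \<le> n \<and> clockwise n C i j k})"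

definition chromatic_number :: "'a hypergraph \<Rightarrow> nat" where
  "chromatic_number H = (LEAST m. \<exists>P. partition_on (fst H) P \<and> finite P \<and> card P = m \<and>
     (\<forall>e\<in>snd H. \<forall>c\<in>P. \<not> e \<subseteq> c))"

definition winding_size :: "nat \<Rightarrow> nat \<Rightarrow> nat" where
  "winding_size q r = r * (q - 1) + 1"

text \<open>
  Here \<open>cyc_index r i\<close> is the \<open>j\<close> with \<open>1 \<le> j \<le> r\<close> and \<open>i \<equiv> j\<close> modulo \<open>r\<close>.  For positive
  \<open>q\<close>, \<open>r\<close> no subtraction below truncates and the division is exact.
\<close>

definition winding_perm :: "nat \<Rightarrow> nat \<Rightarrow> nat \<Rightarrow> nat" where
  "winding_perm q r = (\<lambda>i\<in>{1..winding_size q r}.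
     if i = winding_size q r then 1
     else let j = cyc_index r i in 2 + (q - 1) * (r - j) + (i - j) div r)"

definition winding_hypergraph :: "nat \<Rightarrow> nat \<Rightarrow> nat hypergraph" where
  "winding_hypergraph q r =
     perm_hypergraph (winding_size q r) (cyclic_perm (winding_size q r) (winding_perm q r))"

lemma winding_perm_5_3:
  "map (winding_perm 5 3) [1..<14] = [10, 6, 2, 11, 7, 3, 12, 8, 4, 13, 9, 5, 1]"
  by (simp add: winding_perm_def winding_size_def cyc_index_def upt_rec)

lemma cyc_index_range: "n > 0 \<Longrightarrow> cyc_index n m \<in> {1..n}"
  by (simp add: cyc_index_def Suc_le_eq)

lemma cyc_index_mod: "m > 0 \<Longrightarrow> cyc_index n m mod n = m mod n"
  by (simp add: cyc_index_def mod_Suc_eq)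

lemma cyc_index_exact: "m > 0 \<Longrightarrow> cyc_index n m \<le> m \<and> n dvd m - cyc_index n m"
  by (cases m) (auto simp: cyc_index_def minus_mod_eq_mult_div)

text \<open>In particular the class \<open>cyclic_perm\<close> of \<open>winding_perm\<close> is not empty.\<close>

lemma winding_perm_in_perms_upto:
  assumes "q > 0" "r > 0"
  shows "winding_perm q r \<in> perms_upto (winding_size q r)"
proof -
  let ?n = "winding_size q r" and ?f = "winding_perm q r"
  have val: "?f i = 2 + (q - 1) * (r - 1 - (i - 1) mod r) + (i - 1) div r"
    and quot: "(i - 1) div r < q - 1" if "1 \<le> i" "i < ?n" for i
  proof -
    have "i - ((i - 1) mod r + 1) = r * ((i - 1) div r)"
      using that by (cases i) (auto simp: minus_mod_eq_mult_div)
    then show "?f i = 2 + (q - 1) * (r - 1 - (i - 1) mod r) + (i - 1) div r"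
      using that assms by (simp add: winding_perm_def cyc_index_def)
    show "(i - 1) div r < q - 1"
      using that assms
      by (intro less_mult_imp_div_less) (auto simp: winding_size_def mult.commute)
  qed
  have bnd: "2 \<le> ?f i \<and> ?f i \<le> ?n" if "1 \<le> i" "i < ?n" for i
  proof -
    have "(q - 1) * (r - 1 - (i - 1) mod r) \<le> (q - 1) * (r - 1)"
      by (intro mult_le_mono) auto
    moreover have "(q - 1) * (r - 1) + (q - 1) = r * (q - 1)"
      using assms by (cases r) (auto simp: algebra_simps)
    ultimately show ?thesis
      using val[OF that] quot[OF that] unfolding winding_size_def by linarith
  qed
  have last: "?f ?n = 1"
    by (simp add: winding_perm_def winding_size_def)
  have inj: "inj_on ?f {1..?n}"
  proof (rule inj_onI)
    fix x y assume x: "x \<in> {1..?n}" and y: "y \<in> {1..?n}" and eq: "?f x = ?f y"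
    show "x = y"
    proof (cases "x = ?n \<or> y = ?n")
      case True
      then show ?thesis
        using last bnd[of x] bnd[of y] x y eq by fastforce
    next
      case False
      then have x': "1 \<le> x" "x < ?n" and y': "1 \<le> y" "y < ?n" using x y by auto
      let ?d = "q - 1"
      let ?a = "(x - 1) div r" and ?b = "r - 1 - (x - 1) mod r"
      let ?a' = "(y - 1) div r" and ?b' = "r - 1 - (y - 1) mod r"
      have e: "?d * ?b + ?a = ?d * ?b' + ?a'"
        using eq val[OF x'] val[OF y'] by simp
      have "?a = ?a'"
        using arg_cong[OF e, of "\<lambda>t. t mod ?d"] quot[OF x'] quot[OF y'] by simp
      moreover have "?b = ?b'"
        using e \<open>?a = ?a'\<close> quot[OF x'] by auto
      moreover have "(x - 1) mod r < r" "(y - 1) mod r < r" using assms by auto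
      ultimately have "(x - 1) mod r = (y - 1) mod r" by linarith
      then have "x - 1 = y - 1"
        using \<open>?a = ?a'\<close> by (metis mult_div_mod_eq)
      then show ?thesis using x' y' by simp
    qed
  qed
  have "?f ` {1..?n} \<subseteq> {1..?n}"
  proof
    fix v assume "v \<in> ?f ` {1..?n}"
    then obtain i where i: "i \<in> {1..?n}" "v = ?f i" by auto
    show "v \<in> {1..?n}"
      using i last bnd[of i] by (cases "i = ?n") auto
  qed
  then have "?f ` {1..?n} = {1..?n}"
    by (intro endo_inj_surj inj) auto
  with inj show ?thesis
    by (auto simp: perms_upto_def bij_betw_def winding_perm_def)
qed

end

theory Submission
  imports Defs "HOL-Number_Theory.Cong"
begin

text \<open>
  Since \<open>r (q - 1) \<equiv> -1\<close> modulo \<open>n\<close>, the value \<open>v\<close> sits at position \<open>r (v - 1)\<close> modulo \<open>n\<close> of the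
  winding permutation, so \<open>i < j < k\<close> is an edge iff \<open>r (j - i) mod n < r (k - i) mod n\<close>.

  If \<open>A\<close> contains no edge and has minimum \<open>a\<close>, the residues \<open>r (t - a) mod n\<close> decrease in
  \<open>t \<in> A - {a}\<close>; hence the quotients \<open>r (t - a) div n < r\<close> increase strictly and \<open>card A \<le> r + 1\<close>.
  Conversely, for \<open>k = \<lceil>n / (r + 1)\<rceil>\<close> each residue class modulo \<open>k\<close> has at most \<open>r + 1\<close> elements,
  and a step by \<open>k\<close> moves the position backwards by \<open>s = n - r k\<close>, where \<open>r s < n\<close>. A class is thus
  run through anticlockwise within a single turn, so it contains no edge.
\<close>

section \<open>Cyclic indices and the members of a rotation class\<close>

lemma cong_eq_of_mem_Icc:
  fixes x y n :: nat
  assumes "[x = y] (mod n)" "x \<in> {1..n}" "y \<in> {1..n}"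
  shows "x = y"
proof -
  have "[Suc (x - 1) = Suc (y - 1)] (mod n)" using assms by simp
  then have "[x - 1 = y - 1] (mod n)"
    using cong_add_lcancel_nat[of 1 "x - 1" "y - 1" n] by simp
  then have "x - 1 = y - 1"
    using assms by (intro cong_less_modulus_unique_nat) auto
  then show ?thesis using assms by auto
qed

lemma cyc_index_cong: "m > 0 \<Longrightarrow> [cyc_index n m = m] (mod n)"
  by (simp add: cong_def cyc_index_mod)

lemma bij_betw_cyc_index_shift:
  assumes "n > 0"
  shows "bij_betw (\<lambda>p. cyc_index n (p + m)) {1..n} {1..n}"
proof -
  have inj: "inj_on (\<lambda>p. cyc_index n (p + m)) {1..n}"
  proof (rule inj_onI)
    fix x y
    assume xy: "x \<in> {1..n}" "y \<in> {1..n}" and "cyc_index n (x + m) = cyc_index n (y + m)"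
    then have "[x + m = y + m] (mod n)"
      using cyc_index_cong[of "x + m" n] cyc_index_cong[of "y + m" n] by (auto simp: cong_def)
    then show "x = y" using xy by (intro cong_eq_of_mem_Icc) (auto simp: cong_add_rcancel_nat)
  qed
  moreover have "(\<lambda>p. cyc_index n (p + m)) ` {1..n} \<subseteq> {1..n}"
    using cyc_index_range[OF assms] by blast
  ultimately show ?thesis
    by (simp add: bij_betw_def endo_inj_surj)
qed

text \<open>\<open>clockwise\<close> asks for some member of the class; this supplies one with any
  prescribed shift, so that a chosen element can later be put in first place.\<close>

lemma rotation_in_cyclic_perm:
  assumes "n > 0" "\<phi> \<in> perms_upto n"
  obtains \<psi> where "\<psi> \<in> perms_upto n" "\<psi> \<in> cyclic_perm n \<phi>"
    "\<forall>i\<in>{1..n}. \<phi> i = \<psi> (cyc_index n (i + k))"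
proof -
  \<comment> \<open>The shift \<open>(n - 1) * k\<close> plays the part of \<open>- k\<close> modulo
    \<open>n\<close> without subtraction in the naturals; the restriction to \<open>{1..n}\<close>
    gives the extensionality that \<open>perms_upto\<close> demands.\<close>
  define \<psi> where "\<psi> = (\<lambda>p\<in>{1..n}. \<phi> (cyc_index n (p + (n - 1) * k)))"
  have "bij_betw (\<lambda>p. \<phi> (cyc_index n (p + (n - 1) * k))) {1..n} {1..n}"
    using bij_betw_trans[OF bij_betw_cyc_index_shift[OF assms(1)], of \<phi> "{1..n}"] assms(2)
    by (auto simp: perms_upto_def comp_def)
  then have \<psi>: "\<psi> \<in> perms_upto n"
    unfolding perms_upto_def \<psi>_def mem_Collect_eq
    by (intro conjI restrict_extensional) (subst bij_betw_restrict_eq)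
  moreover have rot: "\<forall>i\<in>{1..n}. \<phi> i = \<psi> (cyc_index n (i + k))"
  proof
    fix i assume i: "i \<in> {1..n}"
    let ?c = "cyc_index n (i + k)"
    have "[cyc_index n (?c + (n - 1) * k) = ?c + (n - 1) * k] (mod n)"
      by (rule cyc_index_cong) (simp add: cyc_index_def)
    also have "[?c + (n - 1) * k = (i + k) + (n - 1) * k] (mod n)"
      using i by (intro cong_add cyc_index_cong cong_refl) auto
    also have "(i + k) + (n - 1) * k = i + n * k"
      using assms(1) by (cases n) auto
    also have "[i + n * k = i] (mod n)" by (simp add: cong_def)
    finally have "cyc_index n (?c + (n - 1) * k) = i"
      using i cyc_index_range[OF assms(1)] by (intro cong_eq_of_mem_Icc)
    then show "\<phi> i = \<psi> ?c"
      using cyc_index_range[OF assms(1)] by (simp add: \<psi>_def)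
  qed
  moreover have "\<psi> \<in> cyclic_perm n \<phi>"
    using \<psi> rot assms(2) unfolding cyclic_perm_def rotation_rel_def by blast
  ultimately show ?thesis using that by blast
qed

section \<open>Positions in the winding permutation and its edges\<close>

lemma winding_perm_cong:
  assumes "q > 0" "r > 0" and n: "n = winding_size q r" and i: "i \<in> {1..n}"
  shows "[r * (winding_perm q r i - 1) = i] (mod n)"
proof (cases "i = n")
  case True
  then show ?thesis using i n by (simp add: winding_perm_def cong_def)
next
  case False
  define j a where "j = cyc_index r i" and "a = (i - j) div r"
  have "j \<le> r" using cyc_index_range[OF assms(2), of i] by (simp add: j_def)
  then obtain b where b: "r = j + b" using le_Suc_ex by blast
  then have rj: "r - j = b" by simp
  have ij: "i = j + r * a"
    using cyc_index_exact[of i r] i by (auto simp: j_def a_def)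
  have "winding_perm q r i = 2 + (q - 1) * b + a"
    using False i n by (simp add: winding_perm_def Let_def a_def flip: j_def rj)
  \<comment> \<open>The factor \<open>r\<close> turns \<open>(q - 1) * b\<close> into
    \<open>(n - 1) * b\<close>; the missing \<open>b\<close> comes from \<open>r = j + b\<close>,
    which leaves exactly \<open>i + n * b\<close>.\<close>
  then have "r * (winding_perm q r i - 1) = r + r * (q - 1) * b + r * a"
    by (simp add: algebra_simps)
  also have "\<dots> = i + n * b"
    unfolding n winding_size_def using b ij by (simp add: add_mult_distrib)
  finally show ?thesis by (simp add: cong_def)
qed

text \<open>Every rotation has an affine inverse modulo \<open>n\<close>: the slope is always
  \<open>r\<close> and only the offset \<open>s\<close> depends on the representative.\<close>

lemma inv_rotation_winding_perm:
  assumes "q > 0" "r > 0" and n: "n = winding_size q r"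
    and \<psi>: "\<psi> \<in> perms_upto n" and rot: "\<forall>i\<in>{1..n}. winding_perm q r i = \<psi> (cyc_index n (i + s))"
    and v: "v \<in> {1..n}"
  shows "inv_into {1..n} \<psi> v \<in> {1..n}"
    and "[inv_into {1..n} \<psi> v = r * (v - 1) + s] (mod n)"
proof -
  have n0: "n > 0" by (simp add: n winding_size_def)
  have \<psi>_bij: "bij_betw \<psi> {1..n} {1..n}" using \<psi> by (simp add: perms_upto_def)
  then show "inv_into {1..n} \<psi> v \<in> {1..n}"
    using v by (metis bij_betw_def inv_into_into)
  have "winding_perm q r ` {1..n} = {1..n}"
    using winding_perm_in_perms_upto[OF assms(1,2)] by (simp add: perms_upto_def n bij_betw_def)
  then obtain i where i: "i \<in> {1..n}" "winding_perm q r i = v" using v by (metis imageE)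
  have "inv_into {1..n} \<psi> v = cyc_index n (i + s)"
    using i rot \<psi>_bij cyc_index_range[OF n0] by (metis bij_betw_inv_into_left)
  also have "[cyc_index n (i + s) = i + s] (mod n)"
    using i by (intro cyc_index_cong) auto
  also have "[i + s = r * (v - 1) + s] (mod n)"
    using winding_perm_cong[OF assms(1,2) n i(1)] i(2)
    by (intro cong_add cong_refl) (simp add: cong_sym)
  finally show "[inv_into {1..n} \<psi> v = r * (v - 1) + s] (mod n)" .
qed

text \<open>The offset \<open>s\<close> cancels in a difference of positions. Positions lie in
  \<open>{1..n}\<close>, so this difference is below \<open>n\<close> and equals its own
  residue.\<close>

lemma position_diff_eq_mod:
  fixes P Q i j r s n :: nat
  assumes "[P = r * (i - 1) + s] (mod n)" "[Q = r * (j - 1) + s] (mod n)"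
    and "P \<in> {1..n}" "Q \<in> {1..n}" "P \<le> Q" "1 \<le> i" "i \<le> j"
  shows "Q - P = r * (j - i) mod n"
proof -
  have eq: "r * (j - 1) + s = (r * (i - 1) + s) + r * (j - i)"
  proof -
    obtain a b where "i = Suc a" "j = Suc a + b"
      using assms(6,7) by (metis One_nat_def le_add_diff_inverse plus_1_eq_Suc)
    then show ?thesis by (simp add: algebra_simps)
  qed
  have "[P + (Q - P) = (r * (i - 1) + s) + r * (j - i)] (mod n)"
    using assms(2,5) unfolding eq by simp
  also have "[(r * (i - 1) + s) + r * (j - i) = P + r * (j - i)] (mod n)"
    using assms(1) by (intro cong_add cong_refl) (simp add: cong_sym)
  finally have "[Q - P = r * (j - i)] (mod n)" by (simp add: cong_add_lcancel_nat)
  moreover have "Q - P < n" using assms(3,4) by auto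
  ultimately show ?thesis by (simp add: cong_def)
qed

text \<open>From left to right, any witness has \<open>i\<close> before \<open>j\<close> and
  \<open>k\<close>, so both residues are distances from the position of \<open>i\<close>.
  Conversely, a representative that starts with \<open>i\<close> lists the other elements by
  increasing residue.\<close>

lemma clockwise_winding_iff:
  assumes "q > 0" "r > 0" and n: "n = winding_size q r"
    and ijk: "1 \<le> i" "i < j" "j < k" "k \<le> n"
  shows "clockwise n (cyclic_perm n (winding_perm q r)) i j k \<longleftrightarrow>
    r * (j - i) mod n < r * (k - i) mod n"
proof
  have mem: "i \<in> {1..n}" "j \<in> {1..n}" "k \<in> {1..n}" using ijk by auto
  have n0: "n > 0" by (simp add: n winding_size_def)
  {
    assume "clockwise n (cyclic_perm n (winding_perm q r)) i j k"
    then obtain \<psi> s where \<psi>: "\<psi> \<in> perms_upto n"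
      and rot: "\<forall>i\<in>{1..n}. winding_perm q r i = \<psi> (cyc_index n (i + s))"
      and less: "inv_into {1..n} \<psi> i < inv_into {1..n} \<psi> j" "inv_into {1..n} \<psi> j < inv_into {1..n} \<psi> k"
      by (auto simp: clockwise_def cyclic_perm_def rotation_rel_def)
    note pos = inv_rotation_winding_perm[OF assms(1,2) n \<psi> rot]
    have "inv_into {1..n} \<psi> j - inv_into {1..n} \<psi> i = r * (j - i) mod n"
      using less ijk by (intro position_diff_eq_mod[OF pos(2) pos(2) pos(1) pos(1)] mem) auto
    moreover have "inv_into {1..n} \<psi> k - inv_into {1..n} \<psi> i = r * (k - i) mod n"
      using less ijk by (intro position_diff_eq_mod[OF pos(2) pos(2) pos(1) pos(1)] mem) auto
    ultimately show "r * (j - i) mod n < r * (k - i) mod n" using less by linarith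
  }
  {
    assume less: "r * (j - i) mod n < r * (k - i) mod n"
    \<comment> \<open>the rotation that moves \<open>i\<close> to position 1\<close>
    define s where "s = 1 + (n - 1) * (r * (i - 1))"
    obtain \<psi> where \<psi>: "\<psi> \<in> perms_upto n" "\<psi> \<in> cyclic_perm n (winding_perm q r)"
      and rot: "\<forall>i\<in>{1..n}. winding_perm q r i = \<psi> (cyc_index n (i + s))"
      using rotation_in_cyclic_perm n0 winding_perm_in_perms_upto[OF assms(1,2)] n by metis
    note pos = inv_rotation_winding_perm[OF assms(1,2) n \<psi>(1) rot]
    note pos(2)[OF mem(1)]
    also have "r * (i - 1) + s = 1 + n * (r * (i - 1))"
      unfolding s_def using n0 by (cases n) auto
    also have "[1 + n * (r * (i - 1)) = 1] (mod n)"
      unfolding cong_def by (rule mod_mult_self2)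
    finally have first: "inv_into {1..n} \<psi> i = 1"
      using pos(1)[OF mem(1)] n0 by (intro cong_eq_of_mem_Icc) auto
    have "inv_into {1..n} \<psi> j - inv_into {1..n} \<psi> i = r * (j - i) mod n"
      using first pos(1)[OF mem(2)] ijk
      by (intro position_diff_eq_mod[OF pos(2) pos(2) pos(1) pos(1)] mem) auto
    moreover have "inv_into {1..n} \<psi> k - inv_into {1..n} \<psi> i = r * (k - i) mod n"
      using first pos(1)[OF mem(3)] ijk
      by (intro position_diff_eq_mod[OF pos(2) pos(2) pos(1) pos(1)] mem) auto
    \<comment> \<open>The inequality of residues only puts \<open>j\<close> before \<open>k\<close>;
      that \<open>j\<close> comes strictly after \<open>i\<close> needs injectivity.\<close>
    moreover have "inv_into {1..n} \<psi> j \<noteq> 1"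
    proof -
      have "\<psi> ` {1..n} = {1..n}" using \<psi>(1) by (simp add: perms_upto_def bij_betw_def)
      then have "inv_into {1..n} \<psi> i \<noteq> inv_into {1..n} \<psi> j"
        using mem ijk by (metis inv_into_injective nat_neq_iff)
      then show ?thesis using first by simp
    qed
    ultimately show "clockwise n (cyclic_perm n (winding_perm q r)) i j k"
      using \<psi>(2) first less pos(1)[OF mem(2)] unfolding clockwise_def
      by (intro bexI[of _ \<psi>]) auto
  }
qed

lemma winding_hypergraph_edges:
  assumes "q > 0" "r > 0" "n = winding_size q r"
  shows "snd (winding_hypergraph q r) =
    {{i, j, k} | i j k. 1 \<le> i \<and> i < j \<and> j < k \<and> k \<le> n \<and> r * (j - i) mod n < r * (k - i) mod n}"
proof -
  have "1 \<le> i \<and> i < j \<and> j < k \<and> k \<le> n \<and> clockwise n (cyclic_perm n (winding_perm q r)) i j k \<longleftrightarrow>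
      1 \<le> i \<and> i < j \<and> j < k \<and> k \<le> n \<and> r * (j - i) mod n < r * (k - i) mod n" for i j k
    using clockwise_winding_iff[OF assms] by blast
  then show ?thesis
    unfolding winding_hypergraph_def perm_hypergraph_def snd_conv assms(3)[symmetric] by presburger
qed

lemma winding_hypergraph_edgeI:
  assumes "q > 0" "r > 0" "n = winding_size q r"
    and "1 \<le> i" "i < j" "j < k" "k \<le> n" "r * (j - i) mod n < r * (k - i) mod n"
  shows "{i, j, k} \<in> snd (winding_hypergraph q r)"
  unfolding winding_hypergraph_edges[OF assms(1-3)] using assms(4-) by blast

section \<open>Lower bound: the size of a set without edges\<close>

lemma card_winding_independent_le:
  assumes "q > 0" "r > 0" and n: "n = winding_size q r" and A: "A \<subseteq> {1..n}"
    and indep: "\<forall>e\<in>snd (winding_hypergraph q r). \<not> e \<subseteq> A"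
  shows "card A \<le> r + 1"
proof (cases "A = {}")
  case False
  have fin: "finite A" using A finite_subset by blast
  define a where "a = Min A"
  have a: "a \<in> A" "\<And>t. t \<in> A \<Longrightarrow> a \<le> t" using fin False by (auto simp: a_def)
  \<comment> \<open>\<open>c t\<close> counts the full turns completed on the way from
    \<open>a\<close> to \<open>t\<close>, each unit step advancing the position by
    \<open>r\<close>.\<close>
  define c where "c t = r * (t - a) div n" for t
  have strict: "c j < c k" if jk: "j \<in> A - {a}" "k \<in> A - {a}" "j < k" for j k
  proof -
    have aj: "a < j" using a(2)[of j] jk by auto
    have "{a, j, k} \<notin> snd (winding_hypergraph q r)" using indep jk a(1) by auto
    moreover have "1 \<le> a" "k \<le> n" using jk A a(1) by auto
    ultimately have "r * (k - a) mod n \<le> r * (j - a) mod n"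
      using winding_hypergraph_edgeI[OF assms(1-3) _ aj jk(3)] by (meson not_le)
    \<comment> \<open>Division with remainder of \<open>r * (j - a) < r * (k - a)\<close>: as the
      remainder does not grow, the quotient must.\<close>
    moreover have "n * c j + r * (j - a) mod n < n * c k + r * (k - a) mod n"
      using jk aj assms(2) by (simp add: c_def mult_div_mod_eq)
    ultimately have "n * c j < n * c k" by linarith
    then show ?thesis by simp
  qed
  have "inj_on c (A - {a})"
    by (rule linorder_inj_onI) (use strict in force)+
  moreover have "c ` (A - {a}) \<subseteq> {..<r}"
  proof
    fix y assume "y \<in> c ` (A - {a})"
    then obtain t where t: "t \<in> A" "y = c t" by auto
    have "1 \<le> a" "t \<le> n" using t(1) A a(1) by auto
    then have "t - a < n" using a(2)[OF t(1)] by linarith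
    then show "y \<in> {..<r}"
      using assms(2) t by (auto simp: c_def intro!: less_mult_imp_div_less)
  qed
  ultimately have "card (A - {a}) \<le> r"
    using card_inj_on_le[of c "A - {a}" "{..<r}"] by simp
  then show ?thesis using fin a(1) by (simp add: card_Diff_singleton)
qed simp

section \<open>Upper bound: colouring by residue classes modulo \<open>m\<close>\<close>

lemma residue_class_winding_independent:
  assumes "q > 0" "r > 0" and n: "n = winding_size q r"
    and m: "n \<le> m * (r + 1)" "r * m < n"
    and e: "e \<in> snd (winding_hypergraph q r)"
  shows "\<not> e \<subseteq> {x. x mod m = c}"
proof
  assume sub: "e \<subseteq> {x. x mod m = c}"
  obtain x y z where xyz: "e = {x, y, z}" "1 \<le> x" "x < y" "y < z" "z \<le> n"
    and less: "r * (y - x) mod n < r * (z - x) mod n"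
    using e unfolding winding_hypergraph_edges[OF assms(1-3)] by blast
  have "y mod m = x mod m" "z mod m = x mod m" using sub xyz by auto
  then obtain i j where ij: "y - x = m * i" "z - x = m * j"
    using xyz by (metis mod_eq_dvd_iff_nat less_imp_le_nat less_trans dvdE)
  have "m * i < m * j" using ij xyz by linarith
  then have "i < j" by simp
  \<comment> \<open>\<open>z - x < n\<close> because \<open>x\<close> is at least 1, so at most
    \<open>r\<close> steps of length \<open>m\<close> fit.\<close>
  have "m * j < m * (r + 1)" using ij xyz m by linarith
  then have "j < r + 1" by (metis mult_less_cancel1)
  then have "j \<le> r" by simp
  have "i > 0" using ij xyz by (cases i) auto
  obtain s where s: "n = r * m + s" "s > 0" using m(2) less_imp_add_positive by metis
  have "s \<le> m" using m(1) s by (simp add: algebra_simps)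
  have rs: "r * s < n"
  proof -
    have "r * s \<le> r * m" using \<open>s \<le> m\<close> by simp
    then show ?thesis using m(2) by linarith
  qed
  \<comment> \<open>Since \<open>r * m = n - s\<close>, \<open>t\<close> steps move the position by
    \<open>- t * s\<close>; as \<open>t * s \<le> r * s < n\<close>, this does not wrap around, and
    the residue decreases in \<open>t\<close>, against \<open>less\<close>.\<close>
  have residue: "r * (m * t) mod n = n - t * s" if "0 < t" "t \<le> r" for t
  proof -
    have "t * s \<le> r * s" using that by simp
    then have ts: "t * s < n" using rs by linarith
    have "t * s > 0" using that s(2) by simp
    have "r * (m * t) + t * s = n * t" by (simp add: s(1) algebra_simps)
    also have "\<dots> = n * (t - 1) + n" using that by (cases t) auto
    finally have "r * (m * t) = n * (t - 1) + (n - t * s)" using ts by linarith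
    moreover have "n - t * s < n" using ts \<open>t * s > 0\<close> by linarith
    ultimately show ?thesis by (metis mod_less mod_mult_self4)
  qed
  have "i * s < j * s" "j * s \<le> r * s" using \<open>i < j\<close> \<open>j \<le> r\<close> s(2) by auto
  moreover have "n - i * s < n - j * s"
    using less residue[of i] residue[of j] \<open>i > 0\<close> \<open>i < j\<close> \<open>j \<le> r\<close> ij by simp
  ultimately show False by linarith
qed

lemma partition_on_residue_classes:
  fixes m n :: nat
  assumes "0 < m" "m \<le> n"
  defines "P \<equiv> (\<lambda>c. {x \<in> {1..n}. x mod m = c}) ` {..<m}"
  shows "partition_on {1..n} P" "card P = m"
proof -
  have ne: "\<exists>x\<in>{1..n}. x mod m = c" if "c < m" for c
    \<comment> \<open>The vertex 0 does not exist, so the class of 0 is represented by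
      \<open>m\<close>, which is where \<open>m \<le> n\<close> enters.\<close>
    using that assms by (intro bexI[of _ "if c = 0 then m else c"]) auto
  show "partition_on {1..n} P"
    using ne assms(1) by (intro partition_onI) (fastforce simp: P_def disjnt_iff)+
  have "inj_on (\<lambda>c. {x \<in> {1..n}. x mod m = c}) {..<m}"
  proof (rule inj_onI)
    fix c d
    assume "c \<in> {..<m}" and eq: "{x \<in> {1..n}. x mod m = c} = {x \<in> {1..n}. x mod m = d}"
    then obtain x where "x \<in> {x \<in> {1..n}. x mod m = c}" using ne[of c] by blast
    moreover from this have "x \<in> {x \<in> {1..n}. x mod m = d}" unfolding eq .
    ultimately show "c = d" by blast
  qed
  then show "card P = m" by (simp add: P_def card_image)
qed

lemma winding_colouring_exists:
  assumes "q > 0" "r > 0" and n: "n = winding_size q r"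
    and m: "n \<le> m * (r + 1)" "(m - 1) * (r + 1) < n" "0 < m"
  shows "\<exists>P. partition_on {1..n} P \<and> finite P \<and> card P = m \<and>
    (\<forall>e\<in>snd (winding_hypergraph q r). \<forall>c\<in>P. \<not> e \<subseteq> c)"
proof -
  have "m \<le> n"
  proof -
    have "m - 1 \<le> (m - 1) * (r + 1)" by simp
    then show ?thesis using m by linarith
  qed
  define P where "P = (\<lambda>c. {x \<in> {1..n}. x mod m = c}) ` {..<m}"
  have "\<not> e \<subseteq> c" if e: "e \<in> snd (winding_hypergraph q r)" and "c \<in> P" for e c
  \<comment> \<open>For \<open>q = 1\<close> there is a single vertex and no edge, while
    \<open>m = 1\<close> violates \<open>r * m < n\<close>. Otherwise the minimality of
    \<open>m\<close> gives \<open>m \<le> q - 1\<close>, hence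
    \<open>r * m \<le> n - 1\<close>.\<close>
  proof (cases "q = 1")
    case True
    then have "n = 1" using n by (simp add: winding_size_def)
    then show ?thesis using e unfolding winding_hypergraph_edges[OF assms(1-3)] by auto
  next
    case False
    then have "q - 1 \<ge> 1" using assms(1) by auto
    have "n = r * (q - 1) + 1" using n by (simp add: winding_size_def)
    moreover have "(q - 1) * (r + 1) = r * (q - 1) + (q - 1)" by simp
    ultimately have "(m - 1) * (r + 1) < (q - 1) * (r + 1)"
      using m(2) \<open>q - 1 \<ge> 1\<close> by linarith
    then have "m - 1 < q - 1" by (metis mult_less_cancel2)
    then have "m \<le> q - 1" by linarith
    then have "r * m \<le> r * (q - 1)" by simp
    then have "r * m < n" using \<open>n = r * (q - 1) + 1\<close> by linarith
    with residue_class_winding_independent[OF assms(1-3) m(1) _ e] that show ?thesis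
      by (fastforce simp: P_def)
  qed
  then show ?thesis
    using partition_on_residue_classes[OF m(3) \<open>m \<le> n\<close>]
    by (intro exI[of _ P]) (auto simp: P_def)
qed

theorem lemma4:
  fixes q r n :: nat
  assumes "q > 0" and "r > 0" and "n = r * (q - 1) + 1"
  shows "int (chromatic_number (winding_hypergraph q r)) = \<lceil>real n / real (r + 1)\<rceil>"
proof -
  have n: "n = winding_size q r" by (simp add: assms(3) winding_size_def)
  have verts: "fst (winding_hypergraph q r) = {1..n}"
    by (simp add: winding_hypergraph_def perm_hypergraph_def n)
  define m where "m = nat \<lceil>real n / real (r + 1)\<rceil>"
  have pos: "real n / real (r + 1) > 0" unfolding assms(3) by (intro divide_pos_pos) linarith+
  then have m_int: "int m = \<lceil>real n / real (r + 1)\<rceil>" and m0: "m > 0" by (auto simp: m_def)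
  have "real n / real (r + 1) \<le> real m" "real m - 1 < real n / real (r + 1)"
    using m_int by linarith+
  then have "real n \<le> real m * real (r + 1)" "(real m - 1) * real (r + 1) < real n"
    by (simp_all add: pos_divide_le_eq pos_less_divide_eq)
  moreover have "real m - 1 = real (m - 1)" using m0 by simp
  \<comment> \<open>In the naturals, the ceiling is the least \<open>m\<close> with
    \<open>n \<le> m * (r + 1)\<close>; both bounds together express this.\<close>
  ultimately have m: "n \<le> m * (r + 1)" "(m - 1) * (r + 1) < n"
    by (metis of_nat_le_iff of_nat_mult, metis of_nat_less_iff of_nat_mult)
  have "chromatic_number (winding_hypergraph q r) = m"
    unfolding chromatic_number_def verts
  proof (rule Least_equality)
    show "\<exists>P. partition_on {1..n} P \<and> finite P \<and> card P = m \<and>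
        (\<forall>e\<in>snd (winding_hypergraph q r). \<forall>c\<in>P. \<not> e \<subseteq> c)"
      by (rule winding_colouring_exists[OF assms(1,2) n m m0])
  next
    fix y
    assume "\<exists>P. partition_on {1..n} P \<and> finite P \<and> card P = y \<and>
        (\<forall>e\<in>snd (winding_hypergraph q r). \<forall>c\<in>P. \<not> e \<subseteq> c)"
    then obtain P where P: "partition_on {1..n} P" "finite P" "card P = y"
      and indep: "\<forall>e\<in>snd (winding_hypergraph q r). \<forall>c\<in>P. \<not> e \<subseteq> c"
      by blast
    \<comment> \<open>Each of the \<open>y\<close> classes covers at most \<open>r + 1\<close>
      vertices, so \<open>n \<le> y * (r + 1)\<close>.\<close>
    have "n = card (\<Union>P)" using partition_onD1[OF P(1)] by (metis card_atLeastAtMost diff_Suc_1)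
    also have "\<dots> \<le> (\<Sum>c\<in>P. card c)" by (rule card_Union_le_sum_card)
    also have "\<dots> \<le> (\<Sum>c\<in>P. r + 1)"
      using partition_onD1[OF P(1)] indep
      by (intro sum_mono card_winding_independent_le[OF assms(1,2) n]) auto
    also have "\<dots> = y * (r + 1)" by (simp add: P(3))
    finally have "(m - 1) * (r + 1) < y * (r + 1)" using m(2) by linarith
    then have "m - 1 < y" by (metis mult_less_cancel2)
    then show "m \<le> y" by simp
  qed
  then show ?thesis using m_int by simp
qed

end
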